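(* Let $a$, $b$, $c$ be digits with $b\ge c$, and put $a^+=a+1$. Then: (1) if either ($a\ge c$ and $\delta(a^+,c)=\delta(a,c)$) or ($a<c$ and $\delta(a^+,c)\ne\delta(a,c)$), then $$(a,b)\bowtie c=a^+\clubsuit c+\delta(b,c);$$ (2) if either ($a\ge c$ and $\delta(a^+,c)\ne\delta(a,c)$) or ($a<c$ and $\delta(a^+,c)=\delta(a,c)$), then $$(a,b)\bowtie c=(a^+\clubsuit c+10)+\delta(b,c).$$
   Context: A digit is an element of $\{0,1,\dots,9\}$. For nonnegative integers $x,y$, let $u\in\{0,\dots,9\}$ be the ones digit of the usual product $x\times y$. The plum-blossom product $x\clubsuit y$ is defined by $x\clubsuit y=u$ if $u\le 3$, and $x\clubsuit y=u-10$ if $u>3$. The carry $J(x\clubsuit y)$ is the integer determined by $x\times y=10\,J(x\clubsuit y)+x\clubsuit y$; it depends on the pair $(x,y)$, not only on the value $x\clubsuit y$. The integer $\delta(x,y)$ is defined by $J(x\clubsuit y)=\min(x,y)+\delta(x,y)$. These definitions are also used when $a^+=10$ (the case $a=9$). For digits $a,b,c$, the plum-blossom wedge product of $(a,b)$ and $c$ is $(a,b)\bowtie c=a\clubsuit c+J(b\clubsuit c)$. *)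

theory Defs
  imports Main
begin

definition is_digit :: "nat \<Rightarrow> bool" where
  "is_digit d \<longleftrightarrow> d \<in> {0..9}"

definition plum :: "nat \<Rightarrow> nat \<Rightarrow> int" (infixl "\<clubsuit>" 70) where
  "x \<clubsuit> y = (let u = (x * y) mod 10 in if u \<le> 3 then int u else int u - 10)"

text \<open>The carry is a function of the pair of factors; the division below is exact, and
  \<open>plum_carry_iff\<close> shows that it is the unique solution of the defining equation.\<close>

definition plum_carry :: "nat \<Rightarrow> nat \<Rightarrow> int" where
  "plum_carry x y = (int (x * y) - x \<clubsuit> y) div 10"

lemma plum_carry_iff: "plum_carry x y = j \<longleftrightarrow> int (x * y) = 10 * j + x \<clubsuit> y"
proof -
  have "int (x * y) = 10 * int (x * y div 10) + int (x * y mod 10)"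
    by (simp flip: of_nat_add of_nat_mult add: zdiv_int zmod_int)
  then have "\<exists>k. int (x * y) - x \<clubsuit> y = 10 * k"
    unfolding plum_def Let_def by presburger
  then show ?thesis
    unfolding plum_carry_def by auto
qed

definition plum_delta :: "nat \<Rightarrow> nat \<Rightarrow> int" where
  "plum_delta x y = plum_carry x y - int (min x y)"

definition plum_wedge :: "nat \<times> nat \<Rightarrow> nat \<Rightarrow> int" (infixl "\<bowtie>" 70) where
  "p \<bowtie> c = (case p of (a, b) \<Rightarrow> a \<clubsuit> c + plum_carry b c)"

end

theory Submission
  imports Defs
begin

text \<open>Let $d = J(a^+ \clubsuit c) - J(a \clubsuit c)$. Comparing $a^+ c = a c + c$ with the defining
  equation of the carry gives $a \clubsuit c + c = a^+ \clubsuit c + 10 d$, and since all values of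
  $\clubsuit$ lie in $[-6, 3]$ and $0 \le c \le 9$, we have $d \in \{0, 1\}$. For $b \ge c$ the carry
  $J(b \clubsuit c)$ is $c + \delta(b, c)$, so
  $(a, b) \bowtie c = a^+ \clubsuit c + 10 d + \delta(b, c)$. As $\min(a^+, c) - \min(a, c)$ is $0$ for
  $a \ge c$ and $1$ for $a < c$, the two cases of the theorem are exactly $d = 0$ and $d = 1$.\<close>

lemma plum_bounds: "- 6 \<le> x \<clubsuit> y" "x \<clubsuit> y \<le> 3"
  by (auto simp: plum_def Let_def)

lemma mult_eq_carry_plum: "int (x * y) = 10 * plum_carry x y + x \<clubsuit> y"
  using plum_carry_iff by blast

lemma plum_add_multiplier:
  "a \<clubsuit> c + int c = (a + 1) \<clubsuit> c + 10 * (plum_carry (a + 1) c - plum_carry a c)"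
  using mult_eq_carry_plum[of a c] mult_eq_carry_plum[of "a + 1" c]
  by (simp add: algebra_simps)

text \<open>Ten times the difference is \<open>c\<close> plus a difference of two values in [-6, 3],
  so it lies between -9 and 18, where 0 and 10 are the only multiples of 10.\<close>

lemma plum_carry_step:
  assumes "is_digit c"
  shows "plum_carry (a + 1) c - plum_carry a c \<in> {0, 1}"
proof -
  have "c \<le> 9"
    using assms by (simp add: is_digit_def)
  then show ?thesis
    using plum_add_multiplier[of a c] plum_bounds[of a c] plum_bounds[of "a + 1" c] by auto
qed

theorem theorem3:
  fixes a b c :: nat
  assumes "is_digit a" and "is_digit b" and "is_digit c" and "b \<ge> c"
  shows "((a \<ge> c \<and> plum_delta (a + 1) c = plum_delta a c) \<or>
          (a < c \<and> plum_delta (a + 1) c \<noteq> plum_delta a c) \<longrightarrow>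
            (a, b) \<bowtie> c = (a + 1) \<clubsuit> c + plum_delta b c) \<and>
         ((a \<ge> c \<and> plum_delta (a + 1) c \<noteq> plum_delta a c) \<or>
          (a < c \<and> plum_delta (a + 1) c = plum_delta a c) \<longrightarrow>
            (a, b) \<bowtie> c = ((a + 1) \<clubsuit> c + 10) + plum_delta b c)"
proof -
  define d where "d = plum_carry (a + 1) c - plum_carry a c"
  have d: "d = 0 \<or> d = 1"
    using plum_carry_step[OF \<open>is_digit c\<close>, of a] by (simp add: d_def)
  \<comment> \<open>As \<open>min b c = c\<close>, the second carry supplies the summand
    \<open>c\<close> that turns \<open>a\<close> into \<open>a + 1\<close>.\<close>
  have wedge: "(a, b) \<bowtie> c = (a + 1) \<clubsuit> c + 10 * d + plum_delta b c"
    using plum_add_multiplier[of a c] \<open>b \<ge> c\<close>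
    by (simp add: plum_wedge_def plum_delta_def d_def)
  \<comment> \<open>Equal deltas thus mean \<open>d = 0\<close> if \<open>c \<le> a\<close> but
    \<open>d = 1\<close> if \<open>a < c\<close>, hence the swapped conditions in the two
    cases.\<close>
  have delta: "plum_delta (a + 1) c - plum_delta a c = d - (if a < c then 1 else 0)"
    by (auto simp: plum_delta_def d_def min_def)
  show ?thesis
    using d wedge delta by (auto split: if_splits)
qed

end
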